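(* For every dataset with $n\ge 2$ points $x_1,\dots,x_n\in\mathbb{R}^p$ (in general position) and $p\ge n-1$ variables: (i) $d_{x_i,\bar x}=(n-1)\,n^{-1/2}$ for every $i=1,\dots,n$; and (ii) $d_{x_i,x_j}=\{2(n-1)\}^{1/2}$ for every $i\ne j$ in $\{1,\dots,n\}$. In other words, whatever the points, as long as $p\ge n-1$, the Mahalanobis distance from every point to the center is a constant and the Mahalanobis distance between any two distinct points is another constant, both constants depending only on $n$.
   Context: For points $x_1,\dots,x_n\in\mathbb{R}^p$, let $X$ be the $n\times p$ data matrix whose $i$-th row is $x_i^T$, let $\bar x=\frac1n\sum_{i=1}^n x_i$, and let $S=\frac{1}{n-1}\sum_{i=1}^n (x_i-\bar x)(x_i-\bar x)^T$ be the $p\times p$ sample covariance matrix. The points are said to be in general position if $X$ has maximal rank, that is, $\operatorname{rank}(X)=\min(p,n)$. The Mahalanobis distances are $d_{x_i,\bar x}=\{(x_i-\bar x)^TS^{-1}(x_i-\bar x)\}^{1/2}$ and $d_{x_i,x_j}=\{(x_i-x_j)^TS^{-1}(x_i-x_j)\}^{1/2}$, where, when $S$ is singular, $S^{-1}$ is replaced by the Moore–Penrose generalized inverse of $S$.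
   Formalization: In the case p = n−1 the points are also assumed not to lie on a common hyperplane (their affine hull is R^p); maximal rank of X alone does not suffice there, e.g. n = 2, p = 1, x_1 = x_2 = 1 gives S = 0 and zero distances. *)

theory Defs
  imports "HOL-Analysis.Analysis"
begin

text \<open>
  A dataset of n points in R^p is a function \<open>x :: 'n::finite \<Rightarrow> real ^ 'p\<close>,
  so that \<open>n = CARD('n)\<close> and \<open>p = CARD('p)\<close>.
\<close>

definition data_matrix :: "('n::finite \<Rightarrow> real ^ 'p) \<Rightarrow> real ^ 'p ^ 'n" where
  "data_matrix x = (\<chi> i. x i)"

text \<open>
  Maximal rank of the uncentered data matrix. For \<open>p = n - 1\<close> this does not make the
  points affinely independent (two equal nonzero points in \<open>p = 1\<close>), and the sample
  covariance matrix may then have rank below \<open>n - 1\<close>.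
\<close>

definition general_position :: "('n::finite \<Rightarrow> real ^ 'p) \<Rightarrow> bool" where
  "general_position x \<longleftrightarrow> rank (data_matrix x) = min CARD('p) CARD('n)"

definition sample_mean :: "('n::finite \<Rightarrow> real ^ 'p) \<Rightarrow> real ^ 'p" where
  "sample_mean x = (1 / real CARD('n)) *\<^sub>R (\<Sum>i\<in>UNIV. x i)"

definition outer_product :: "real ^ 'p \<Rightarrow> real ^ 'q \<Rightarrow> real ^ 'q ^ 'p" where
  "outer_product u v = (\<chi> i j. u $ i * v $ j)"

definition sample_cov :: "('n::finite \<Rightarrow> real ^ 'p) \<Rightarrow> real ^ 'p ^ 'p" where
  "sample_cov x = (1 / (real CARD('n) - 1)) *\<^sub>R
     (\<Sum>i\<in>UNIV. outer_product (x i - sample_mean x) (x i - sample_mean x))"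

definition is_moore_penrose :: "real ^ 'n ^ 'm \<Rightarrow> real ^ 'm ^ 'n \<Rightarrow> bool" where
  "is_moore_penrose A B \<longleftrightarrow>
     A ** B ** A = A \<and> B ** A ** B = B \<and>
     transpose (A ** B) = A ** B \<and> transpose (B ** A) = B ** A"

definition moore_penrose :: "real ^ 'n ^ 'm \<Rightarrow> real ^ 'm ^ 'n" where
  "moore_penrose A = (THE B. is_moore_penrose A B)"

lemma is_moore_penrose_unique:
  assumes "is_moore_penrose A B" "is_moore_penrose A C"
  shows "B = C"
proof -
  have B: "A ** B ** A = A" "B ** A ** B = B"
      "transpose (A ** B) = A ** B" "transpose (B ** A) = B ** A"
    and C: "A ** C ** A = A" "C ** A ** C = C"
      "transpose (A ** C) = A ** C" "transpose (C ** A) = C ** A"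
    using assms by (auto simp: is_moore_penrose_def)
  have "A ** B = transpose ((A ** C) ** (A ** B))"
    using B(3) C(1) by (simp add: matrix_mul_assoc)
  also have "\<dots> = (A ** B) ** (A ** C)"
    using B(3) C(3) by (simp only: matrix_transpose_mul[of "A ** C" "A ** B"])
  also have "\<dots> = A ** C"
    using B(1) by (simp add: matrix_mul_assoc)
  finally have AB: "A ** B = A ** C" .
  have "B ** A = transpose ((B ** A) ** (C ** A))"
    using B(4) C(1) by (metis matrix_mul_assoc)
  also have "\<dots> = (C ** A) ** (B ** A)"
    using B(4) C(4) by (simp only: matrix_transpose_mul[of "B ** A" "C ** A"])
  also have "\<dots> = C ** A"
    using B(1) by (metis matrix_mul_assoc)
  finally have BA: "B ** A = C ** A" .
  have "B = B ** (A ** B)" using B(2) by (simp add: matrix_mul_assoc)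
  also have "\<dots> = C ** A ** C" using AB BA by (simp add: matrix_mul_assoc)
  finally show ?thesis using C(2) by simp
qed

lemma is_moore_penrose_exists:
  fixes A :: "real ^ 'n ^ 'm"
  shows "\<exists>B. is_moore_penrose A B"
proof -
  define N where "N = {v. A *v v = 0}"
  define R where "R = range ((*v) A)"
  define P where "P = (\<lambda>y u. (\<forall>v\<in>N. u \<bullet> v = 0) \<and> (\<forall>r\<in>R. (y - A *v u) \<bullet> r = 0))"
  have N: "subspace N" unfolding N_def
    by (auto simp: subspace_def matrix_vector_right_distrib scaleR_matrix_vector_assoc[symmetric]
        matrix_vector_mult_scaleR)
  have R: "subspace R" unfolding R_def
    by (intro linear_subspace_image matrix_vector_mul_linear subspace_UNIV)
  have ex: "\<exists>u. P y u" for y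
  proof -
    obtain r s where r: "r \<in> span R" "\<And>w. w \<in> span R \<Longrightarrow> orthogonal s w" "y = r + s"
      using orthogonal_subspace_decomp_exists[of R y] by metis
    obtain u0 where u0: "r = A *v u0"
      using r(1) R by (auto simp: span_eq_iff[THEN iffD2] R_def)
    obtain v u where u: "v \<in> span N" "\<And>w. w \<in> span N \<Longrightarrow> orthogonal u w" "u0 = v + u"
      using orthogonal_subspace_decomp_exists[of N u0] by metis
    have "A *v v = 0" using u(1) N by (simp add: span_eq_iff[THEN iffD2] N_def)
    then have "A *v u = r" using u(3) u0 by (simp add: matrix_vector_right_distrib)
    then have "P y u" using r u unfolding P_def
      by (auto simp: orthogonal_def span_base)
    then show ?thesis ..
  qed
  have uniq: "u = u'" if "P y u" "P y u'" for y u u'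
  proof -
    have d: "A *v (u' - u) \<in> R" by (simp add: R_def)
    have "A *v (u' - u) = (y - A *v u) - (y - A *v u')"
      by (simp add: matrix_vector_mult_diff_distrib)
    then have "(A *v (u' - u)) \<bullet> (A *v (u' - u)) = 0"
      using that d unfolding P_def by (metis diff_zero inner_diff_left)
    then have "u' - u \<in> N" by (simp add: N_def)
    then have "(u' - u) \<bullet> (u' - u) = 0"
      using that unfolding P_def by (metis diff_zero inner_diff_left)
    then show ?thesis by simp
  qed
  obtain g where g: "\<And>y. P y (g y)" using ex by metis
  have lin: "linear g"
  proof
    fix a b :: "real ^ 'm" and c :: real
    have "P (a + b) (g a + g b)"
      using g[of a] g[of b] unfolding P_def
      by (auto simp: matrix_vector_right_distrib inner_add_left inner_diff_left)
    then show "g (a + b) = g a + g b" using g uniq by blast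
    have "P (c *\<^sub>R a) (c *\<^sub>R g a)"
      using g[of a] unfolding P_def
      by (auto simp: matrix_vector_mult_scaleR inner_diff_left)
    then show "g (c *\<^sub>R a) = c *\<^sub>R g a" using g uniq by blast
  qed
  define B where "B = matrix g"
  have Bv: "B *v y = g y" for y
    unfolding B_def using lin by (intro matrix_works) (simp only: linear_matrix_vector_mul_eq)
  have inR: "A *v u \<in> R" for u by (simp add: R_def)
  have AgA: "A *v g (A *v u) = A *v u" for u
  proof -
    have "(A *v u - A *v g (A *v u)) \<in> R"
      by (metis inR matrix_vector_mult_diff_distrib)
    then have "(A *v u - A *v g (A *v u)) \<bullet> (A *v u - A *v g (A *v u)) = 0"
      using g[of "A *v u"] unfolding P_def by blast
    then show ?thesis by simp
  qed
  have gAg: "g (A *v g y) = g y" for y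
    using uniq[of "A *v g y"] g[of "A *v g y"] g[of y] unfolding P_def by auto
  have 1: "A ** B ** A = A" and 2: "B ** A ** B = B"
    by (simp_all add: matrix_eq matrix_vector_mul_assoc[symmetric] Bv AgA gAg)
  have s1: "z \<bullet> (A *v g y) = (A *v g z) \<bullet> (A *v g y)" for y z
  proof -
    have "(z - A *v g z) \<bullet> (A *v g y) = 0" using g[of z] inR[of "g y"] unfolding P_def by blast
    then show ?thesis by (simp add: inner_diff_left)
  qed
  have s2: "g (A *v u) \<bullet> z = g (A *v u) \<bullet> g (A *v z)" for u z
  proof -
    have "z - g (A *v z) \<in> N"
      by (simp add: N_def matrix_vector_mult_diff_distrib AgA)
    then have "g (A *v u) \<bullet> (z - g (A *v z)) = 0" using g[of "A *v u"] unfolding P_def by blast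
    then show ?thesis by (simp add: inner_diff_right)
  qed
  have sym: "transpose M = M" if "\<And>u z. (M *v u) \<bullet> z = u \<bullet> (M *v z)"
    for M :: "real ^ 'k ^ 'k"
  proof -
    have "(transpose M *v u - M *v u) \<bullet> z = 0" for u z
      using that[of u z] by (simp add: inner_diff_left transpose_matrix_vector dot_lmul_matrix)
    then have "transpose M *v u - M *v u = 0" for u by (metis inner_eq_zero_iff)
    then show ?thesis by (simp add: matrix_eq)
  qed
  have 3: "transpose (A ** B) = A ** B"
  proof (rule sym)
    fix u z
    show "((A ** B) *v u) \<bullet> z = u \<bullet> ((A ** B) *v z)"
      using s1[of u z] s1[of z u] inner_commute[of "A *v g u" z] inner_commute[of "A *v g u" "A *v g z"]
      by (simp add: matrix_vector_mul_assoc[symmetric] Bv)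
  qed
  have 4: "transpose (B ** A) = B ** A"
  proof (rule sym)
    fix u z
    show "((B ** A) *v u) \<bullet> z = u \<bullet> ((B ** A) *v z)"
      using s2[of u z] s2[of z u] inner_commute[of u "g (A *v z)"] inner_commute[of "g (A *v u)" "g (A *v z)"]
      by (simp add: matrix_vector_mul_assoc[symmetric] Bv)
  qed
  show ?thesis using 1 2 3 4 unfolding is_moore_penrose_def by blast
qed

lemma is_moore_penrose_moore_penrose: "is_moore_penrose A (moore_penrose A)"
  unfolding moore_penrose_def
  by (rule theI') (use is_moore_penrose_exists is_moore_penrose_unique in blast)

definition gen_inverse :: "real ^ 'p ^ 'p \<Rightarrow> real ^ 'p ^ 'p" where
  "gen_inverse A = (if invertible A then matrix_inv A else moore_penrose A)"

definition mahalanobis :: "('n::finite \<Rightarrow> real ^ 'p) \<Rightarrow> real ^ 'p \<Rightarrow> real ^ 'p \<Rightarrow> real" where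
  "mahalanobis x u v = sqrt ((u - v) \<bullet> (gen_inverse (sample_cov x) *v (u - v)))"

end

theory Submission
  imports Defs
begin

text \<open>
  Let \<open>y i = x i - sample_mean x\<close>. The hypotheses provide vectors \<open>w i\<close> with
  \<open>y j \<bullet> w i = (if i = j then 1 else 0) - 1 / n\<close>, because an affine function can take
  arbitrary values at the points. Then \<open>S w i = y i / (n - 1)\<close>, so from \<open>S G S = S\<close> and the
  symmetry of \<open>S\<close> one gets \<open>y i \<bullet> G y j = (n - 1) * (y i \<bullet> w j)\<close>, which determines all
  the distances.
\<close>

text \<open>Both branches of \<open>gen_inverse\<close> satisfy this Penrose equation, so singular
  and invertible covariance matrices can be treated alike.\<close>

lemma mult_gen_inverse_mult: "A ** gen_inverse A ** A = A"
proof (cases "invertible A")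
  case True
  then have "\<exists>B. A ** B = mat 1 \<and> B ** A = mat 1"
    by (simp add: invertible_def)
  then have "A ** matrix_inv A = mat 1 \<and> matrix_inv A ** A = mat 1"
    unfolding matrix_inv_def by (rule someI_ex)
  then show ?thesis
    using True by (simp add: gen_inverse_def)
next
  case False
  then show ?thesis
    using is_moore_penrose_moore_penrose[of A]
    by (simp add: gen_inverse_def is_moore_penrose_def)
qed

lemma outer_product_mult_vec: "outer_product u v *v w = (v \<bullet> w) *\<^sub>R u"
  by (simp add: vec_eq_iff outer_product_def matrix_vector_mult_def inner_vec_def
      sum_distrib_left sum_distrib_right mult_ac)

lemma sum_mult_vec: "(\<Sum>i\<in>I. A i) *v w = (\<Sum>i\<in>I. A i *v (w :: real ^ 'q))"
  by (induction I rule: infinite_finite_induct) (auto simp: matrix_vector_mult_add_rdistrib)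

lemma sample_cov_mult_vec:
  "sample_cov x *v w = (1 / (real CARD('n) - 1)) *\<^sub>R
     (\<Sum>i\<in>UNIV. ((x i - sample_mean x) \<bullet> w) *\<^sub>R (x i - sample_mean x))"
  for x :: "'n::finite \<Rightarrow> real ^ 'p"
  by (simp add: sample_cov_def scaleR_matrix_vector_assoc[symmetric] sum_mult_vec
      outer_product_mult_vec)

lemma sample_cov_symmetric: "(sample_cov x *v u) \<bullet> w = u \<bullet> (sample_cov x *v w)"
  by (simp add: sample_cov_mult_vec inner_sum_left inner_sum_right inner_commute mult.commute)

lemma sum_centered: "(\<Sum>i\<in>UNIV. x i - sample_mean x) = 0"
  for x :: "'n::finite \<Rightarrow> real ^ 'p"
  by (simp add: sample_mean_def sum_subtractf sum_constant_scaleR del: sum_constant)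

text \<open>Averaging the hypothesis over all points gives the value 1/n at the mean; subtracting it
  cancels the constant \<open>c\<close>.\<close>

lemma centered_inner_dual:
  fixes x :: "'n::finite \<Rightarrow> real ^ 'p"
  assumes "\<And>j. x j \<bullet> w + c = (if i = j then 1 else 0)"
  shows "(x j - sample_mean x) \<bullet> w = (if i = j then 1 else 0) - 1 / real CARD('n)"
proof -
  have x: "x j \<bullet> w = (if i = j then 1 else 0) - c" for j
    using assms[of j] by simp
  have "(\<Sum>j\<in>UNIV. x j \<bullet> w) = 1 - real CARD('n) * c"
    by (simp add: x sum_subtractf)
  then have "sample_mean x \<bullet> w = 1 / real CARD('n) - c"
    by (simp add: sample_mean_def inner_sum_left field_simps)
  then show ?thesis
    by (simp add: inner_diff_left x)
qed

text \<open>If p \<ge> n, maximal rank makes the n points linearly independent, and a linear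
  functional with \<open>c = 0\<close> suffices. If p = n - 1, the p + 1 = n parameters
  \<open>(w, c)\<close> match the n prescribed values, and the points span affinely, so evaluation
  is injective and hence surjective.\<close>

lemma affine_interpolation:
  fixes x :: "'n::finite \<Rightarrow> real ^ 'p"
  assumes "CARD('p) \<ge> CARD('n) - 1"
    and "general_position x"
    and "CARD('p) = CARD('n) - 1 \<longrightarrow> affine hull (range x) = UNIV"
  shows "\<exists>w c. \<forall>j. x j \<bullet> w + c = b $ j"
proof (cases "CARD('p) = CARD('n) - 1")
  case False
  then have "rank (data_matrix x) = CARD('n)"
    using assms by (simp add: general_position_def)
  then have "surj ((*v) (data_matrix x))"
    by (simp add: full_rank_surjective)
  then obtain w where w: "b = data_matrix x *v w"
    by blast
  have "x j \<bullet> w + 0 = b $ j" for j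
    by (simp add: w data_matrix_def matrix_vector_mult_def inner_vec_def)
  then show ?thesis by blast
next
  case True
  define f :: "(real ^ 'p) \<times> real \<Rightarrow> real ^ 'n" where "f = (\<lambda>(w, c). \<chi> j. x j \<bullet> w + c)"
  have lin: "linear f"
    by (auto simp: f_def linear_iff vec_eq_iff inner_add_right algebra_simps)
  have "inj f"
    unfolding linear_injective_0[OF lin]
  proof (intro allI impI)
    fix z assume "f z = 0"
    then obtain w c where z: "z = (w, c)" and x: "\<And>j. x j \<bullet> w + c = 0"
      by (cases z) (auto simp: f_def vec_eq_iff)
    have "w \<bullet> x j = - c" for j
      using x[of j] by (simp add: inner_commute)
    then have "range x \<subseteq> {v. w \<bullet> v = - c}"
      by auto
    then have "affine hull (range x) \<subseteq> {v. w \<bullet> v = - c}"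
      by (rule hull_minimal) (rule affine_hyperplane)
    then have *: "w \<bullet> v = - c" for v
      using assms(3) True by auto
    \<comment> \<open>The affine function vanishes at all points, hence on all of R^p. Its value at
      0 is \<open>c\<close>; with \<open>c = 0\<close>, its value at \<open>w\<close> is the squared
      norm of \<open>w\<close>.\<close>
    from *[of 0] have "c = 0" by simp
    with *[of w] show "z = 0" by (simp add: z prod_eq_iff)
  qed
  then have "dim (range f) = DIM((real ^ 'p) \<times> real)"
    using dim_image_eq[OF lin, of UNIV] by (simp add: dim_UNIV)
  \<comment> \<open>Positivity of n rules out truncation in n - 1, so (n - 1) + 1 = n.\<close>
  also have "\<dots> = DIM(real ^ 'n)"
    using True zero_less_card_finite[where 'a = 'n] by simp
  finally have "span (range f) = UNIV"
    by (simp only: dim_eq_full)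
  then have "surj f"
    using linear_subspace_image[OF lin subspace_UNIV] by (metis span_eq_iff)
  then obtain w c where "b = f (w, c)"
    by (metis surjD surj_pair)
  then have "\<forall>j. x j \<bullet> w + c = b $ j"
    by (simp add: f_def)
  then show ?thesis by blast
qed

text \<open>The right-hand side is an entry of n - 1 times the centering projection I - J/n, with J
  the all-ones matrix. Every centered point lies in the range of S, where S G S = S determines the
  bilinear form of G.\<close>

lemma inner_gen_inverse_centered:
  fixes x :: "'n::finite \<Rightarrow> real ^ 'p"
  assumes "CARD('n) \<ge> 2"
    and "CARD('p) \<ge> CARD('n) - 1"
    and "general_position x"
    and "CARD('p) = CARD('n) - 1 \<longrightarrow> affine hull (range x) = UNIV"
  shows "(x i - sample_mean x) \<bullet> (gen_inverse (sample_cov x) *v (x j - sample_mean x))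
    = (real CARD('n) - 1) * ((if i = j then 1 else 0) - 1 / real CARD('n))"
proof -
  let ?S = "sample_cov x" and ?n = "real CARD('n)"
  define y where "y = (\<lambda>i. x i - sample_mean x)"
  have "\<exists>w. \<forall>j. y j \<bullet> w = (if i = j then 1 else 0) - 1 / ?n" for i
  proof -
    obtain w c where "\<forall>j. x j \<bullet> w + c = axis i 1 $ j"
      using affine_interpolation[OF assms(2-4), of "axis i 1"] by blast
    then have "x j \<bullet> w + c = (if i = j then 1 else 0)" for j
      by (auto simp: axis_def)
    then show ?thesis
      unfolding y_def by (intro exI[of _ w] allI centered_inner_dual)
  qed
  then obtain w where w: "\<And>i j. y j \<bullet> w i = (if i = j then 1 else 0) - 1 / ?n"
    by metis
  have Sw: "(?n - 1) *\<^sub>R (?S *v w i) = y i" for i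
  proof -
    \<comment> \<open>The Kronecker delta picks out \<open>y i\<close>; the constant 1/n multiplies
      the sum of the centered points, which is 0.\<close>
    have "(\<Sum>j\<in>UNIV. (y j \<bullet> w i) *\<^sub>R y j)
      = (\<Sum>j\<in>UNIV. (if i = j then y j else 0)) - (1 / ?n) *\<^sub>R (\<Sum>j\<in>UNIV. y j)"
      unfolding w scaleR_sum_right sum_subtractf[symmetric]
      by (rule sum.cong) (auto simp: scaleR_diff_left)
    then show ?thesis
      using assms(1) sum_centered[of x]
      by (simp add: sample_cov_mult_vec y_def)
  qed
  have "y i \<bullet> (gen_inverse ?S *v y j)
    = (?n - 1) * ((?n - 1) * ((?S *v w i) \<bullet> (gen_inverse ?S *v (?S *v w j))))"
    unfolding Sw[symmetric, of i] Sw[symmetric, of j] by (simp add: matrix_vector_mult_scaleR)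
  also have "(?S *v w i) \<bullet> (gen_inverse ?S *v (?S *v w j))
    = w i \<bullet> ((?S ** gen_inverse ?S ** ?S) *v w j)"
    by (simp add: sample_cov_symmetric matrix_vector_mul_assoc matrix_mul_assoc)
  also have "\<dots> = (?S *v w i) \<bullet> w j"
    by (simp add: mult_gen_inverse_mult sample_cov_symmetric)
  \<comment> \<open>One of the two factors n - 1 turns \<open>?S *v w i\<close> back into
    \<open>y i\<close>; the other remains in the result.\<close>
  also have "(?n - 1) * \<dots> = y i \<bullet> w j"
    by (simp flip: Sw)
  finally show ?thesis
    unfolding w unfolding y_def by auto
qed

theorem theorem1:
  fixes x :: "'n::finite \<Rightarrow> real ^ 'p"
  assumes "CARD('n) \<ge> 2"
    and "CARD('p) \<ge> CARD('n) - 1"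
    and "general_position x"
    and "CARD('p) = CARD('n) - 1 \<longrightarrow> affine hull (range x) = UNIV"
  shows "(\<forall>i. mahalanobis x (x i) (sample_mean x)
              = (real CARD('n) - 1) / sqrt (real CARD('n))) \<and>
         (\<forall>i j. i \<noteq> j \<longrightarrow> mahalanobis x (x i) (x j) = sqrt (2 * (real CARD('n) - 1)))"
proof (intro conjI allI impI)
  note inner = inner_gen_inverse_centered[OF assms]
  let ?n = "real CARD('n)"
  have n: "?n \<ge> 2"
    using assms(1) by simp
  show "mahalanobis x (x i) (sample_mean x) = (?n - 1) / sqrt ?n" for i
  proof -
    \<comment> \<open>The diagonal entry is written with a square, whose root is n - 1 because n
      \<ge> 2.\<close>
    have "(?n - 1) * (1 - 1 / ?n) = (?n - 1)\<^sup>2 / ?n"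
      by (simp add: field_simps power2_eq_square)
    then show ?thesis
      using n by (simp add: mahalanobis_def inner real_sqrt_divide)
  qed
  show "mahalanobis x (x i) (x j) = sqrt (2 * (?n - 1))" if "i \<noteq> j" for i j
  proof -
    \<comment> \<open>Passing through the mean expands the squared distance into two diagonal
      entries (n - 1)(1 - 1/n) minus two off-diagonal entries -(n - 1)/n; the 1/n terms
      cancel.\<close>
    define a b where "a = x i - sample_mean x" and "b = x j - sample_mean x"
    have "x i - x j = a - b"
      by (simp add: a_def b_def)
    then show ?thesis
      using that unfolding mahalanobis_def
      by (simp add: matrix_vector_mult_diff_distrib inner_diff_left inner_diff_right)
         (simp only: a_def b_def inner, simp add: algebra_simps)
  qed
qed

end
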